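(* Consider the outer gradient method $$x_{k+1}=x_k-\frac{\mu_2}{L_{11}\mu_2+L_{12}^2}\,\nabla_x f(x_k,\hat y_k),\qquad k=0,1,2,\dots,$$ where for each $k$ the point $\hat y_k$ is the output of the inner gradient method $y_{m+1}=y_m+\frac{1}{L_{22}}\nabla_y f(x_k,y_m)$ stopped at the first $m$ for which $\|\nabla_y f(x_k,y_m)\|\le\mu_2\gamma$ (and $\hat y_k=y_m$ for this $m$). Let $g(x)=\max_y f(x,y)$, let $C_1>0$ be such that $g(x_0)-g(x^* )\le C_1$, and put $$N_*=\left\lceil \frac{L_{11}\mu_2+L_{12}^2}{\mu_1\mu_2}\log\left(\frac{C_1\mu_1}{6L_{12}^2\gamma^2}\right)\right\rceil .$$ Suppose that either the outer method runs for $N=N_*$ steps, or for some $N\le N_*$ the stopping criterion $$\|\nabla_x f(x_N,\hat y_N)\|\le L_{12}\gamma\sqrt6$$ is satisfied for the first time at the $N$-th iteration. Then the output point $\hat x=x_N$ satisfies $$\|\hat x-x^*\|\le\frac{L_{12}\gamma\sqrt{14}}{\mu_1}.$$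
   Context: Let $f:\mathbb{R}^n\times\mathbb{R}^{m_0}\to\mathbb{R}$ be differentiable; $\|\cdot\|$ is the Euclidean norm. The problem is to find a point $(x^*,y^* )$ with $f(x^*,y^* )=\min_x\max_y f(x,y)$, which is assumed to exist. Here $x^*$ denotes a minimizer of $g(x)=\max_y f(x,y)$; if the minimizer is not unique, in the bound on $\|\hat x-x^*\|$ it is the one nearest to $\hat x$. Two-sided Polyak–Łojasiewicz (PL) condition, with $\mu_1,\mu_2>0$: for all $x,y$, $$\|\nabla_x f(x,y)\|^2\ge 2\mu_1\big(f(x,y)-\min_{x'} f(x',y)\big),\qquad \|\nabla_y f(x,y)\|^2\ge 2\mu_2\big(\max_{y'} f(x,y')-f(x,y)\big),$$ where the minima over $x'$ and maxima over $y'$ are finite and attained (nonempty solution sets). Lipschitz conditions, with positive constants $L_{11},L_{12},L_{22}$: for all $x,x_1,x_2,y,y_1,y_2$, $$\|\nabla_x f(x_1,y)-\nabla_x f(x_2,y)\|\le L_{11}\|x_1-x_2\|,\quad \|\nabla_x f(x,y_1)-\nabla_x f(x,y_2)\|\le L_{12}\|y_1-y_2\|,$$ $$\|\nabla_y f(x,y_1)-\nabla_y f(x,y_2)\|\le L_{22}\|y_1-y_2\|,\quad \|\nabla_y f(x_1,y)-\nabla_y f(x_2,y)\|\le L_{12}\|x_1-x_2\|.$$ The number $\gamma>0$ is a fixed accuracy parameter for the inner problems $\max_y f(x_k,y)$. The starting points $x_0$ and those of the inner methods are arbitrary. The vector $\nabla_x f(x_k,\hat y_k)$ serves as an inexact gradient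 of $g$ at $x_k$. The logarithm is natural. *)

theory Defs
  imports "HOL-Analysis.Analysis"
begin

definition grad :: "('a::real_inner \<Rightarrow> real) \<Rightarrow> 'a \<Rightarrow> 'a" where
  "grad h z = (THE D. GDERIV h z :> D)"

definition gradx :: "('a::real_inner \<times> 'b::real_inner \<Rightarrow> real) \<Rightarrow> 'a \<Rightarrow> 'b \<Rightarrow> 'a" where
  "gradx f x y = grad (\<lambda>u. f (u, y)) x"

definition grady :: "('a::real_inner \<times> 'b::real_inner \<Rightarrow> real) \<Rightarrow> 'a \<Rightarrow> 'b \<Rightarrow> 'b" where
  "grady f x y = grad (\<lambda>v. f (x, v)) y"

text \<open>Here and below, INF and SUP over the reals stand for minima and maxima. They are only used
  for functions that attain them; the attainment is part of \<open>two_sided_PL\<close>.\<close>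

definition max_fun :: "('a \<times> 'b \<Rightarrow> real) \<Rightarrow> 'a \<Rightarrow> real" where
  "max_fun f x = (SUP y. f (x, y))"

definition two_sided_PL ::
  "real \<Rightarrow> real \<Rightarrow> ('a::real_inner \<times> 'b::real_inner \<Rightarrow> real) \<Rightarrow> bool" where
  "two_sided_PL \<mu>1 \<mu>2 f \<longleftrightarrow>
     (\<forall>y. \<exists>x. is_arg_min (\<lambda>u. f (u, y)) (\<lambda>_. True) x) \<and>
     (\<forall>x. \<exists>y. is_arg_max (\<lambda>v. f (x, v)) (\<lambda>_. True) y) \<and>
     (\<forall>x y. (norm (gradx f x y))\<^sup>2 \<ge> 2 * \<mu>1 * (f (x, y) - (INF u. f (u, y)))) \<and>
     (\<forall>x y. (norm (grady f x y))\<^sup>2 \<ge> 2 * \<mu>2 * ((SUP v. f (x, v)) - f (x, y)))"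

definition lipschitz_gradients ::
  "real \<Rightarrow> real \<Rightarrow> real \<Rightarrow> ('a::real_inner \<times> 'b::real_inner \<Rightarrow> real) \<Rightarrow> bool" where
  "lipschitz_gradients L11 L12 L22 f \<longleftrightarrow>
     (\<forall>y. L11-lipschitz_on UNIV (\<lambda>x. gradx f x y)) \<and>
     (\<forall>x. L12-lipschitz_on UNIV (\<lambda>y. gradx f x y)) \<and>
     (\<forall>x. L22-lipschitz_on UNIV (\<lambda>y. grady f x y)) \<and>
     (\<forall>y. L12-lipschitz_on UNIV (\<lambda>x. grady f x y))"

definition minimax_point :: "('a \<times> 'b \<Rightarrow> real) \<Rightarrow> 'a \<Rightarrow> 'b \<Rightarrow> bool" where
  "minimax_point f x y \<longleftrightarrow>
     is_arg_min (max_fun f) (\<lambda>_. True) x \<and> f (x, y) = max_fun f x"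

primrec inner_iter ::
  "real \<Rightarrow> ('a::real_inner \<times> 'b::real_inner \<Rightarrow> real) \<Rightarrow> 'a \<Rightarrow> 'b \<Rightarrow> nat \<Rightarrow> 'b" where
  "inner_iter L f x y0 0 = y0"
| "inner_iter L f x y0 (Suc m) =
     inner_iter L f x y0 m + (1 / L) *\<^sub>R grady f x (inner_iter L f x y0 m)"

text \<open>The output of gradient ascent stopped at the first iterate whose gradient norm is at most
  \<open>\<epsilon>\<close>. If \<open>\<lambda>v. f (x, v)\<close> is \<open>L\<close>-smooth and bounded above, and \<open>\<epsilon> > 0\<close>, such an iterate
  exists, so the LEAST is meaningful.\<close>

definition inner_output ::
  "real \<Rightarrow> real \<Rightarrow> ('a::real_inner \<times> 'b::real_inner \<Rightarrow> real) \<Rightarrow> 'a \<Rightarrow> 'b \<Rightarrow> 'b" where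
  "inner_output L \<epsilon> f x y0 =
     inner_iter L f x y0 (LEAST m. norm (grady f x (inner_iter L f x y0 m)) \<le> \<epsilon>)"

text \<open>The minimizer of \<open>g\<close> nearest to \<open>p\<close>, as a predicate; all such points are equidistant
  from \<open>p\<close>.\<close>

definition nearest_minimizer :: "('a::real_normed_vector \<Rightarrow> real) \<Rightarrow> 'a \<Rightarrow> 'a \<Rightarrow> bool" where
  "nearest_minimizer g p z \<longleftrightarrow>
     is_arg_min (\<lambda>u. norm (p - u)) (\<lambda>u. is_arg_min g (\<lambda>_. True) u) z"

text \<open>The logarithm may be negative; the number of steps is then read as 0, which is what \<open>nat\<close>
  does.\<close>

definition num_steps :: "real \<Rightarrow> real \<Rightarrow> real \<Rightarrow> real \<Rightarrow> real \<Rightarrow> real \<Rightarrow> nat" where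
  "num_steps \<mu>1 \<mu>2 L11 L12 \<gamma> C1 =
     nat \<lceil>(L11 * \<mu>2 + L12\<^sup>2) / (\<mu>1 * \<mu>2) * ln (C1 * \<mu>1 / (6 * L12\<^sup>2 * \<gamma>\<^sup>2))\<rceil>"

end

theory Submission
  imports Defs
begin

text \<open>The function \<open>g = max_fun f\<close> inherits from \<open>f\<close> the two properties on which gradient descent
  relies, both with the vector \<open>gradx f x y\<close> as gradient at \<open>x\<close>, where \<open>y\<close> is any maximizer of
  \<open>f (x, \<cdot>)\<close>. Write \<open>L = L11 + L12\<^sup>2 / \<mu>2\<close>; the step length of the outer method is \<open>1 / L\<close>.

  \<^item> A quadratic upper bound with constant \<open>L\<close> (\<open>max_fun_upper\<close>). At a nearby point \<open>u\<close> the old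
    maximizer \<open>y\<close> has \<open>y\<close>-gradient at most \<open>L12 * norm (u - x)\<close>, so by the PL condition in \<open>y\<close> it
    misses \<open>g u\<close> by at most \<open>L12\<^sup>2 / (2 * \<mu>2) * (norm (u - x))\<^sup>2\<close>; smoothness of \<open>f\<close> in the first
    argument contributes the rest.
  \<^item> The PL inequality with constant \<open>\<mu>1\<close> (\<open>max_fun_PL\<close>), because a minimum of \<open>f (\<cdot>, y)\<close> cannot
    exceed the minimum of \<open>g\<close>.

  These two properties imply quadratic growth, \<open>\<mu> / 2 * dist\<^sup>2 \<le> h - min h\<close>, where \<open>dist\<close> is the
  distance to the set of minimizers (\<open>quadratic_growth\<close>). Applied to \<open>- f (x, \<cdot>)\<close>, this says that
  the output of the inner method lies within \<open>\<gamma>\<close> of a maximizer, so the inexact gradient has an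
  error of at most \<open>\<Delta> = L12 * \<gamma>\<close>. Applied to \<open>g\<close>, it turns bounds on the gradient or on the
  residual of \<open>g\<close> into bounds on the distance.

  If the stopping criterion holds, the exact gradient has norm at most \<open>(1 + sqrt 6) * \<Delta>\<close>, hence
  the distance is at most \<open>(1 + sqrt 6) * \<Delta> / \<mu>1\<close>. After the full number of steps, the recursion
  \<open>r\<^sub>k\<^sub>+\<^sub>1 \<le> (1 - \<mu>1 / L) * r\<^sub>k + \<Delta>\<^sup>2 / (2 * L)\<close> for the residuals has reduced them to at most
  \<open>6 * \<Delta>\<^sup>2 / \<mu>1 + \<Delta>\<^sup>2 / (2 * \<mu>1)\<close>, hence the distance is at most \<open>sqrt 13 * \<Delta> / \<mu>1\<close>.
  Both constants are below \<open>sqrt 14\<close>.\<close>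

section \<open>Gradients and the quadratic upper bound\<close>

lemma GDERIV_grad:
  fixes h :: "'a::euclidean_space \<Rightarrow> real"
  assumes "h differentiable (at z)"
  shows "GDERIV h z :> grad h z"
proof -
  obtain h' where h': "(h has_derivative h') (at z)"
    using assms by (auto simp: differentiable_def)
  then interpret bounded_linear h' by (rule has_derivative_bounded_linear)
  have eq: "h' = (\<lambda>v. v \<bullet> adjoint h' 1)"
    using adjoint_works[OF linear_axioms, of _ 1] by (intro ext) simp
  have ex: "GDERIV h z :> adjoint h' 1"
    unfolding gderiv_def by (subst eq[symmetric]) (rule h')
  have unique: "D = E" if "GDERIV h z :> D" "GDERIV h z :> E" for D E
  proof -
    have "(\<lambda>v. v \<bullet> D) = (\<lambda>v. v \<bullet> E)"
      using that unfolding gderiv_def by (rule has_derivative_unique)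
    then show ?thesis using vector_eq_ldot[of D E] by metis
  qed
  show ?thesis
    unfolding grad_def by (rule theI[of "gderiv h z", OF ex unique[OF _ ex]])
qed

text \<open>The descent lemma: after subtracting the quadratic model, the function is nonincreasing
  along the segment from \<open>z\<close> to \<open>u\<close>.\<close>

lemma lipschitz_gradient_upper_bound:
  fixes h :: "'a::euclidean_space \<Rightarrow> real"
  assumes G: "\<And>z. GDERIV h z :> G z" and lip: "L-lipschitz_on UNIV G"
  shows "h u \<le> h z + G z \<bullet> (u - z) + L / 2 * (norm (u - z))\<^sup>2"
proof -
  define d where "d = u - z"
  define p where "p t = h (z + t *\<^sub>R d) - t * (G z \<bullet> d) - L / 2 * t\<^sup>2 * (norm d)\<^sup>2" for t
  have "p 1 \<le> p 0"
  proof (rule DERIV_nonpos_imp_nonincreasing[of 0 1])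
    fix t :: real
    assume t: "0 \<le> t" "t \<le> 1"
    have "((\<lambda>t. h (z + t *\<^sub>R d)) has_derivative (\<lambda>s. (s *\<^sub>R d) \<bullet> G (z + t *\<^sub>R d))) (at t)"
      by (rule has_derivative_compose[where g = h])
         (auto intro!: derivative_eq_intros G[unfolded gderiv_def])
    then have "((\<lambda>t. h (z + t *\<^sub>R d)) has_field_derivative G (z + t *\<^sub>R d) \<bullet> d) (at t)"
      by (simp add: has_field_derivative_def inner_commute mult.commute[of _ "inner _ _"]
          mult_commute_abs)
    then have "(p has_field_derivative
        G (z + t *\<^sub>R d) \<bullet> d - G z \<bullet> d - L * t * (norm d)\<^sup>2) (at t)"
      unfolding p_def by (auto intro!: derivative_eq_intros)
    moreover have "(G (z + t *\<^sub>R d) - G z) \<bullet> d \<le> L * t * (norm d)\<^sup>2"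
    proof -
      have "(G (z + t *\<^sub>R d) - G z) \<bullet> d \<le> norm (G (z + t *\<^sub>R d) - G z) * norm d"
        by (rule norm_cauchy_schwarz)
      also have "\<dots> \<le> (L * (t * norm d)) * norm d"
        using lipschitz_onD[OF lip, of "z + t *\<^sub>R d" z] t
        by (intro mult_right_mono) (auto simp: dist_norm)
      finally show ?thesis by (simp add: power2_eq_square mult_ac)
    qed
    ultimately show "\<exists>y. DERIV p t :> y \<and> y \<le> 0"
      by (intro exI conjI) (auto simp: inner_diff_left)
  qed simp
  then show ?thesis by (simp add: p_def d_def)
qed

section \<open>Quadratic growth\<close>

text \<open>The slope estimate behind quadratic growth: \<open>sqrt (h - b)\<close> has slope \<open>norm G / (2 * r)\<close> at \<open>z\<close>
  in the direction of steepest descent, and a lower bound that decreases at rate \<open>c\<close> leaves no room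
  for a larger slope. A quadratic upper bound takes the place of a derivative, because this is the
  form in which \<open>max_fun f\<close> inherits smoothness from \<open>f\<close>.\<close>

lemma slope_le:
  fixes h :: "'a::euclidean_space \<Rightarrow> real"
  assumes up: "\<And>u. h u \<le> h z + G \<bullet> (u - z) + L / 2 * (norm (u - z))\<^sup>2"
    and low: "\<And>u. r - c * norm (u - z) \<le> sqrt (h u - b)" and b: "\<And>u. b \<le> h u"
    and r: "r = sqrt (h z - b)" "r > 0" and "c > 0" "L > 0"
  shows "norm G \<le> 2 * c * r"
proof (rule ccontr)
  define n where "n = norm G"
  assume "\<not> ?thesis"
  then have n: "n > 2 * c * r" by (simp add: n_def)
  moreover have "2 * c * r > 0" using assms by simp
  ultimately have "n > 0" by linarith
  \<comment> \<open>The first bound on the step keeps \<open>r - c * s * n\<close> nonnegative, so that it may be squared;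
      the second makes the quadratic term smaller than the first-order gain.\<close>
  define s where "s = min (r / (c * n)) ((n - 2 * c * r) / (L * n))"
  have "s > 0" using n \<open>n > 0\<close> assms by (simp add: s_def)
  have "s \<le> r / (c * n)" "s \<le> (n - 2 * c * r) / (L * n)" by (simp_all add: s_def)
  then have s: "c * s * n \<le> r" "L * s * n \<le> n - 2 * c * r"
    using \<open>n > 0\<close> \<open>c > 0\<close> \<open>L > 0\<close> by (simp_all add: pos_le_divide_eq mult_ac)
  define u where "u = z - s *\<^sub>R G"
  have nu: "norm (u - z) = s * n" using \<open>s > 0\<close> by (simp add: u_def n_def)
  have "(r - c * s * n)\<^sup>2 \<le> (sqrt (h u - b))\<^sup>2"
    using low[of u] s by (intro power_mono) (auto simp: nu mult_ac)
  also have "\<dots> = h u - b" using b[of u] by simp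
  also have "\<dots> \<le> h z - b - s * n\<^sup>2 + L / 2 * (s * n)\<^sup>2"
    using up[of u] unfolding nu by (simp add: u_def n_def power2_norm_eq_inner)
  also have "h z - b = r\<^sup>2" using r b[of z] by simp
  finally have "s * n * (n - 2 * c * r) + (c * s * n)\<^sup>2 \<le> s * n * (L * s * n / 2)"
    by (simp add: power2_eq_square algebra_simps)
  then have "s * n * (n - 2 * c * r) \<le> s * n * (L * s * n / 2)"
    using zero_le_power2[of "c * s * n"] by linarith
  then have "n - 2 * c * r \<le> L * s * n / 2"
    using \<open>s > 0\<close> \<open>n > 0\<close> by (simp add: mult_le_cancel_left_pos)
  with s n show False by linarith
qed

text \<open>Minimizing \<open>sqrt (h - h m) + c * norm (\<cdot> - p)\<close> over \<open>u\<close> produces a point where \<open>sqrt (h - h m)\<close> has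
  slope at most \<open>c\<close>. Where \<open>h\<close> exceeds its minimum, the PL inequality forces a slope of at least
  \<open>sqrt (\<mu> / 2)\<close>, so for smaller \<open>c\<close> the point found is a minimizer of \<open>h\<close>. This takes the place of
  following the gradient flow from \<open>p\<close>.\<close>

lemma minimizer_within:
  fixes h :: "'a::euclidean_space \<Rightarrow> real"
  assumes cont: "continuous_on UNIV h" and m: "\<And>u. h m \<le> h u"
    and model: "\<And>z. \<exists>G. (\<forall>u. h u \<le> h z + G \<bullet> (u - z) + L / 2 * (norm (u - z))\<^sup>2) \<and>
                        2 * \<mu> * (h z - h m) \<le> (norm G)\<^sup>2"
    and "L > 0" "c > 0" "2 * c\<^sup>2 < \<mu>"
  obtains z where "h z = h m" "c * norm (p - z) \<le> sqrt (h p - h m)"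
proof -
  define \<phi> where "\<phi> u = sqrt (h u - h m)" for u
  have \<phi>_nonneg: "\<phi> u \<ge> 0" for u using m[of u] by (simp add: \<phi>_def)
  define \<psi> where "\<psi> u = \<phi> u + c * norm (u - p)" for u
  have "\<exists>z\<in>cball p (\<phi> p / c). \<forall>u\<in>cball p (\<phi> p / c). \<psi> z \<le> \<psi> u"
  proof (rule continuous_attains_inf)
    show "cball p (\<phi> p / c) \<noteq> {}" using \<phi>_nonneg[of p] \<open>c > 0\<close> by (simp add: not_less)
    show "continuous_on (cball p (\<phi> p / c)) \<psi>"
      unfolding \<psi>_def \<phi>_def
      by (intro continuous_intros continuous_on_subset[OF cont]) auto
  qed simp
  then obtain z where z: "\<And>u. u \<in> cball p (\<phi> p / c) \<Longrightarrow> \<psi> z \<le> \<psi> u" by blast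
  have zp: "\<psi> z \<le> \<phi> p"
    using z[of p] \<phi>_nonneg[of p] \<open>c > 0\<close> by (simp add: \<psi>_def)
  have min: "\<psi> z \<le> \<psi> u" for u
  proof (cases "u \<in> cball p (\<phi> p / c)")
    case False
    then have "\<phi> p \<le> c * norm (u - p)"
      using \<open>c > 0\<close> by (simp add: dist_norm norm_minus_commute field_simps)
    then show ?thesis using zp \<phi>_nonneg[of u] unfolding \<psi>_def[of u] by linarith
  qed (rule z)
  have low: "\<phi> z - c * norm (u - z) \<le> \<phi> u" for u
  proof -
    have "c * norm (u - p) \<le> c * norm (u - z) + c * norm (z - p)"
      using norm_triangle_ineq[of "u - z" "z - p"] \<open>c > 0\<close>
      by (simp flip: distrib_left)
    then show ?thesis using min[of u] by (simp add: \<psi>_def)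
  qed
  have "\<phi> z = 0"
  proof (rule ccontr)
    assume "\<phi> z \<noteq> 0"
    then have pos: "\<phi> z > 0" using \<phi>_nonneg[of z] by simp
    obtain G where G: "\<And>u. h u \<le> h z + G \<bullet> (u - z) + L / 2 * (norm (u - z))\<^sup>2"
      and PL: "2 * \<mu> * (h z - h m) \<le> (norm G)\<^sup>2" using model[of z] by blast
    have "norm G \<le> 2 * c * \<phi> z"
      using G low m pos \<open>c > 0\<close> \<open>L > 0\<close>
      by (intro slope_le[where h = h and b = "h m" and L = L]) (auto simp: \<phi>_def)
    then have "(norm G)\<^sup>2 \<le> (2 * c * \<phi> z)\<^sup>2" by (rule power_mono) simp
    moreover have "h z - h m = (\<phi> z)\<^sup>2" using m[of z] by (simp add: \<phi>_def)
    ultimately have "\<mu> * (\<phi> z)\<^sup>2 \<le> 2 * c\<^sup>2 * (\<phi> z)\<^sup>2"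
      using PL by (simp add: power_mult_distrib)
    with pos \<open>2 * c\<^sup>2 < \<mu>\<close> show False by simp
  qed
  show thesis
  proof
    show "h z = h m" using \<open>\<phi> z = 0\<close> by (simp add: \<phi>_def)
    show "c * norm (p - z) \<le> sqrt (h p - h m)"
      using zp \<open>\<phi> z = 0\<close> by (simp add: \<psi>_def \<phi>_def norm_minus_commute)
  qed
qed

text \<open>The sharp constant comes from letting \<open>c\<close> tend to \<open>sqrt (\<mu> / 2)\<close> in \<open>minimizer_within\<close>, since the
  nearest minimizer satisfies all these bounds at once.\<close>

lemma quadratic_growth:
  fixes h :: "'a::euclidean_space \<Rightarrow> real"
  assumes cont: "continuous_on UNIV h" and m: "\<And>u. h m \<le> h u"
    and model: "\<And>z. \<exists>G. (\<forall>u. h u \<le> h z + G \<bullet> (u - z) + L / 2 * (norm (u - z))\<^sup>2) \<and>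
                        2 * \<mu> * (h z - h m) \<le> (norm G)\<^sup>2"
    and "L > 0" "\<mu> > 0"
  obtains z where "nearest_minimizer h p z" "\<mu> / 2 * (norm (p - z))\<^sup>2 \<le> h p - h m"
proof -
  have argmin: "is_arg_min h (\<lambda>_. True) u \<longleftrightarrow> h u = h m" for u
    using m by (auto simp: is_arg_min_linorder intro: antisym)
  have closed: "closed {u. h u = h m}"
    using cont by (intro closed_Collect_eq) (auto intro: continuous_intros)
  have "{u. h u = h m} \<noteq> {}" by blast
  from distance_attains_inf[OF closed this, of p] obtain z where "z \<in> {u. h u = h m}"
      "\<And>u. u \<in> {u. h u = h m} \<Longrightarrow> dist p z \<le> dist p u"
    by metis
  then have z: "h z = h m" "\<And>u. h u = h m \<Longrightarrow> dist p z \<le> dist p u" by simp_all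
  have bound: "c * norm (p - z) \<le> sqrt (h p - h m)" if c: "c > 0" "2 * c\<^sup>2 < \<mu>" for c
  proof -
    obtain w where "h w = h m" "c * norm (p - w) \<le> sqrt (h p - h m)"
      using minimizer_within[OF cont m model \<open>L > 0\<close> c] by blast
    moreover have "c * norm (p - z) \<le> c * norm (p - w)"
      using z(2)[of w] \<open>h w = h m\<close> \<open>c > 0\<close> by (simp add: dist_norm)
    ultimately show ?thesis by simp
  qed
  have "sqrt (\<mu> / 2) * norm (p - z) \<le> sqrt (h p - h m)"
  proof (rule ccontr)
    assume neg: "\<not> ?thesis"
    have nonneg: "0 \<le> sqrt (h p - h m)" using m[of p] by simp
    have D: "norm (p - z) > 0"
      using neg nonneg by (cases "p = z") auto
    have "sqrt (h p - h m) / norm (p - z) < sqrt (\<mu> / 2)"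
      using neg D by (simp add: divide_less_eq not_le)
    then obtain c where c: "sqrt (h p - h m) / norm (p - z) < c" "c < sqrt (\<mu> / 2)"
      using dense by blast
    have "c > 0" using c(1) nonneg D by (smt (verit) divide_nonneg_pos)
    moreover have "2 * c\<^sup>2 < \<mu>"
      using power_strict_mono[OF c(2), of 2] \<open>c > 0\<close> \<open>\<mu> > 0\<close> by simp
    ultimately have "c * norm (p - z) \<le> sqrt (h p - h m)" by (rule bound)
    with c(1) D show False by (simp add: divide_less_eq)
  qed
  then have "(sqrt (\<mu> / 2) * norm (p - z))\<^sup>2 \<le> (sqrt (h p - h m))\<^sup>2"
    using \<open>\<mu> > 0\<close> by (intro power_mono) auto
  then have "\<mu> / 2 * (norm (p - z))\<^sup>2 \<le> h p - h m"
    using \<open>\<mu> > 0\<close> m[of p] by (simp add: power_mult_distrib)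
  moreover have "nearest_minimizer h p z"
    unfolding nearest_minimizer_def is_arg_min_linorder[of "\<lambda>u. norm (p - u)"] argmin
    using z by (simp add: dist_norm)
  ultimately show thesis using that by blast
qed

text \<open>The error bound: eliminate the residual between quadratic growth and the PL inequality.\<close>

lemma distance_le_of_growth_and_PL:
  fixes d n \<mu> \<delta> :: real
  assumes "\<mu> / 2 * d\<^sup>2 \<le> \<delta>" "2 * \<mu> * \<delta> \<le> n\<^sup>2" "\<mu> > 0" "n \<ge> 0"
  shows "d \<le> n / \<mu>"
proof -
  have "2 * \<mu> * (\<mu> / 2 * d\<^sup>2) \<le> 2 * \<mu> * \<delta>" using assms by (intro mult_left_mono) auto
  then have "(\<mu> * d)\<^sup>2 \<le> n\<^sup>2" using assms(2) by (simp add: power_mult_distrib power2_eq_square mult_ac)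
  then have "\<mu> * d \<le> n" using \<open>n \<ge> 0\<close> by (rule power2_le_imp_le)
  then show ?thesis using \<open>\<mu> > 0\<close> by (simp add: field_simps)
qed

section \<open>The primal function and the inner method\<close>

locale PL_saddle =
  fixes f :: "'a::euclidean_space \<times> 'b::euclidean_space \<Rightarrow> real"
    and \<mu>1 \<mu>2 L11 L12 L22 :: real and xs :: 'a
  assumes diff: "f differentiable_on UNIV"
    and pos: "\<mu>1 > 0" "\<mu>2 > 0" "L11 > 0" "L12 > 0" "L22 > 0"
    and PL: "two_sided_PL \<mu>1 \<mu>2 f"
    and lip: "lipschitz_gradients L11 L12 L22 f"
    and xs: "is_arg_min (max_fun f) (\<lambda>_. True) xs"
begin

definition L :: real where "L = L11 + L12\<^sup>2 / \<mu>2"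

lemma L_pos: "L > 0"
  unfolding L_def using pos by (intro add_pos_pos divide_pos_pos) auto

lemma GDERIV_gradx: "GDERIV (\<lambda>u. f (u, y)) x :> gradx f x y"
  unfolding gradx_def
proof (rule GDERIV_grad)
  have "f differentiable at (x, y)" using diff by (simp add: differentiable_on_def)
  then show "(\<lambda>u. f (u, y)) differentiable at x"
    by (rule differentiable_compose[of f "\<lambda>u. (u, y)"]) simp
qed

lemma GDERIV_grady: "GDERIV (\<lambda>v. f (x, v)) y :> grady f x y"
  unfolding grady_def
proof (rule GDERIV_grad)
  have "f differentiable at (x, y)" using diff by (simp add: differentiable_on_def)
  then show "(\<lambda>v. f (x, v)) differentiable at y"
    by (rule differentiable_compose[of f "\<lambda>v. (x, v)"]) simp
qed

lemma f_upper_x: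
  "f (u, y) \<le> f (x, y) + gradx f x y \<bullet> (u - x) + L11 / 2 * (norm (u - x))\<^sup>2"
  using lip unfolding lipschitz_gradients_def
  by (intro lipschitz_gradient_upper_bound[of "\<lambda>u. f (u, y)"] GDERIV_gradx) auto

lemma minus_f_upper_y:
  "- f (x, v) \<le> - f (x, y) + (- grady f x y) \<bullet> (v - y) + L22 / 2 * (norm (v - y))\<^sup>2"
proof (rule lipschitz_gradient_upper_bound[of "\<lambda>v. - f (x, v)" "\<lambda>v. - grady f x v"])
  show "GDERIV (\<lambda>v. - f (x, v)) z :> - grady f x z" for z
    by (rule GDERIV_minus[OF GDERIV_grady])
  show "L22-lipschitz_on UNIV (\<lambda>v. - grady f x v)"
    using lip by (simp add: lipschitz_gradients_def)
qed

lemma continuous_f: "continuous_on UNIV f"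
  using diff by (rule differentiable_imp_continuous_on)

definition maximizer :: "'a \<Rightarrow> 'b \<Rightarrow> bool" where
  "maximizer x y \<longleftrightarrow> (\<forall>v. f (x, v) \<le> f (x, y))"

lemma ex_maximizer: "\<exists>y. maximizer x y"
  using PL by (auto simp: two_sided_PL_def maximizer_def is_arg_max_linorder)

lemma max_fun_eq: "maximizer x y \<Longrightarrow> max_fun f x = f (x, y)"
  unfolding max_fun_def maximizer_def by (intro cSup_eq_maximum) auto

lemma f_le_max_fun: "f (x, y) \<le> max_fun f x"
proof -
  obtain v where "maximizer x v" using ex_maximizer by blast
  then show ?thesis using max_fun_eq[of x v] by (simp add: maximizer_def)
qed

lemma PL_y: "2 * \<mu>2 * (max_fun f x - f (x, y)) \<le> (norm (grady f x y))\<^sup>2"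
  using PL by (simp add: two_sided_PL_def max_fun_def)

text \<open>The ascent step from \<open>y\<close> of length \<open>1 / L22\<close> gains at least this much. Both the vanishing of
  the gradient at maximizers and the termination of the inner method follow from this.\<close>

lemma ascent_step:
  "f (x, y) + (norm (grady f x y))\<^sup>2 / (2 * L22) \<le> f (x, y + (1 / L22) *\<^sub>R grady f x y)"
  using minus_f_upper_y[of x "y + (1 / L22) *\<^sub>R grady f x y" y] pos
  by (simp add: power2_norm_eq_inner[symmetric] field_simps power2_eq_square)

lemma grady_maximizer:
  assumes "maximizer x y"
  shows "grady f x y = 0"
proof -
  have "(norm (grady f x y))\<^sup>2 / (2 * L22) \<le> 0"
    using ascent_step[of x y] assms unfolding maximizer_def by (smt (verit))
  then show ?thesis using pos by (simp add: divide_le_0_iff)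
qed

lemma max_fun_upper:
  assumes "maximizer x y"
  shows "max_fun f u \<le> max_fun f x + gradx f x y \<bullet> (u - x) + L / 2 * (norm (u - x))\<^sup>2"
proof -
  have "norm (grady f u y) \<le> L12 * norm (u - x)"
    using lip grady_maximizer[OF assms] lipschitz_onD[of L12 UNIV "\<lambda>x. grady f x y" u x]
    by (simp add: lipschitz_gradients_def dist_norm)
  then have "(norm (grady f u y))\<^sup>2 \<le> (L12 * norm (u - x))\<^sup>2" by (rule power_mono) simp
  with PL_y[of u y] have "2 * \<mu>2 * (max_fun f u - f (u, y)) \<le> L12\<^sup>2 * (norm (u - x))\<^sup>2"
    by (simp add: power_mult_distrib)
  then have "max_fun f u \<le> f (u, y) + L12\<^sup>2 / \<mu>2 / 2 * (norm (u - x))\<^sup>2"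
    using pos by (simp add: field_simps)
  moreover note f_upper_x[of u y x]
  ultimately show ?thesis
    using max_fun_eq[OF assms] by (simp add: L_def add_divide_distrib distrib_right)
qed

lemma max_fun_min: "max_fun f xs \<le> max_fun f x"
  using xs by (auto simp: is_arg_min_linorder)

lemma max_fun_PL:
  assumes "maximizer x y"
  shows "2 * \<mu>1 * (max_fun f x - max_fun f xs) \<le> (norm (gradx f x y))\<^sup>2"
proof -
  have "\<exists>u. is_arg_min (\<lambda>u. f (u, y)) (\<lambda>_. True) u"
    using PL by (simp add: two_sided_PL_def)
  then have "bdd_below (range (\<lambda>u. f (u, y)))"
    by (auto simp: is_arg_min_linorder bdd_below_def)
  then have "(INF u. f (u, y)) \<le> f (xs, y)" by (rule cINF_lower) simp
  also have "\<dots> \<le> max_fun f xs" by (rule f_le_max_fun)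
  finally have "2 * \<mu>1 * (max_fun f x - max_fun f xs) \<le> 2 * \<mu>1 * (f (x, y) - (INF u. f (u, y)))"
    using pos max_fun_eq[OF assms] by simp
  also have "\<dots> \<le> (norm (gradx f x y))\<^sup>2"
    using PL by (simp add: two_sided_PL_def)
  finally show ?thesis .
qed

text \<open>At \<open>x\<close>, the function is squeezed between \<open>f (\<cdot>, y)\<close>, for a maximizer \<open>y\<close> of \<open>f (x, \<cdot>)\<close>, and the
  quadratic upper bound.\<close>

lemma continuous_max_fun: "continuous_on UNIV (max_fun f)"
  unfolding continuous_on_def
proof
  fix x
  obtain y where y: "maximizer x y" using ex_maximizer by blast
  show "(max_fun f \<longlongrightarrow> max_fun f x) (at x)"
  proof (rule tendsto_sandwich)
    show "\<forall>\<^sub>F u in at x. f (u, y) \<le> max_fun f u"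
      by (simp add: f_le_max_fun)
    show "\<forall>\<^sub>F u in at x. max_fun f u
        \<le> max_fun f x + gradx f x y \<bullet> (u - x) + L / 2 * (norm (u - x))\<^sup>2"
      by (intro always_eventually allI max_fun_upper[OF y])
    have "continuous_on UNIV (\<lambda>u. f (u, y))"
      by (intro continuous_on_compose2[OF continuous_f] continuous_intros) auto
    then show "((\<lambda>u. f (u, y)) \<longlongrightarrow> max_fun f x) (at x)"
      by (simp add: continuous_on_def max_fun_eq[OF y])
    have "((\<lambda>u. max_fun f x + gradx f x y \<bullet> (u - x) + L / 2 * (norm (u - x))\<^sup>2)
        \<longlongrightarrow> max_fun f x + gradx f x y \<bullet> (x - x) + L / 2 * (norm (x - x))\<^sup>2) (at x)"
      by (intro tendsto_intros)
    then show "((\<lambda>u. max_fun f x + gradx f x y \<bullet> (u - x) + L / 2 * (norm (u - x))\<^sup>2)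
        \<longlongrightarrow> max_fun f x) (at x)" by simp
  qed
qed

lemma max_fun_growth:
  obtains z where "nearest_minimizer (max_fun f) p z"
    "\<mu>1 / 2 * (norm (p - z))\<^sup>2 \<le> max_fun f p - max_fun f xs"
proof (rule quadratic_growth[OF continuous_max_fun max_fun_min _ L_pos pos(1), of p])
  show "\<exists>G. (\<forall>u. max_fun f u \<le> max_fun f x + G \<bullet> (u - x) + L / 2 * (norm (u - x))\<^sup>2) \<and>
      2 * \<mu>1 * (max_fun f x - max_fun f xs) \<le> (norm G)\<^sup>2" for x
    using ex_maximizer[of x] max_fun_upper max_fun_PL by blast
qed (rule that)

lemma maximizer_near:
  obtains w where "maximizer x w" "norm (y - w) \<le> norm (grady f x y) / \<mu>2"
proof -
  obtain v where v: "maximizer x v" using ex_maximizer by blast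
  have "continuous_on UNIV (\<lambda>u. - f (x, u))"
    by (intro continuous_on_minus continuous_on_compose2[OF continuous_f] continuous_intros) auto
  moreover have "- f (x, v) \<le> - f (x, u)" for u using v by (simp add: maximizer_def)
  moreover have "\<exists>G. (\<forall>u. - f (x, u) \<le> - f (x, z) + G \<bullet> (u - z) + L22 / 2 * (norm (u - z))\<^sup>2) \<and>
      2 * \<mu>2 * (- f (x, z) - - f (x, v)) \<le> (norm G)\<^sup>2" for z
    using minus_f_upper_y[of x _ z] PL_y[of x z] max_fun_eq[OF v]
    by (intro exI[of _ "- grady f x z"]) simp
  ultimately obtain w where w: "nearest_minimizer (\<lambda>u. - f (x, u)) y w"
      "\<mu>2 / 2 * (norm (y - w))\<^sup>2 \<le> - f (x, y) - - f (x, v)"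
    using quadratic_growth[of "\<lambda>u. - f (x, u)" v L22 \<mu>2 y] pos by blast
  show thesis
  proof
    show "maximizer x w"
      using w(1) by (auto simp: nearest_minimizer_def is_arg_min_linorder maximizer_def)
    show "norm (y - w) \<le> norm (grady f x y) / \<mu>2"
      using w(2) PL_y[of x y] max_fun_eq[OF v] pos
      by (intro distance_le_of_growth_and_PL[of \<mu>2 _ "max_fun f x - f (x, y)"]) auto
  qed
qed

text \<open>As long as the inner method does not stop, each of its steps gains at least
  \<open>\<epsilon>\<^sup>2 / (2 * L22)\<close>, while \<open>f (x, \<cdot>)\<close> is bounded by \<open>max_fun f x\<close>.\<close>

lemma inner_output_grady:
  assumes "\<epsilon> > 0"
  shows "norm (grady f x (inner_output L22 \<epsilon> f x y0)) \<le> \<epsilon>"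
proof -
  let ?y = "inner_iter L22 f x y0"
  have "\<exists>m. norm (grady f x (?y m)) \<le> \<epsilon>"
  proof (rule ccontr)
    assume never: "\<not> ?thesis"
    define \<delta> where "\<delta> = \<epsilon>\<^sup>2 / (2 * L22)"
    have "\<delta> > 0" using assms pos by (simp add: \<delta>_def)
    have gain: "f (x, y0) + real m * \<delta> \<le> f (x, ?y m)" for m
    proof (induction m)
      case (Suc m)
      have "\<epsilon> \<le> norm (grady f x (?y m))" using never by (meson linear)
      then have "\<delta> \<le> (norm (grady f x (?y m)))\<^sup>2 / (2 * L22)"
        using assms pos unfolding \<delta>_def by (intro divide_right_mono power_mono) auto
      then show ?case
        using Suc ascent_step[of x "?y m"] by (simp add: distrib_right)
    qed simp
    obtain m where "max_fun f x - f (x, y0) < real m * \<delta>"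
      using reals_Archimedean3[OF \<open>\<delta> > 0\<close>] by blast
    with gain[of m] f_le_max_fun[of x "?y m"] show False by linarith
  qed
  then show ?thesis unfolding inner_output_def by (rule LeastI_ex)
qed

text \<open>Different outputs may be close to different maximizers \<open>w\<close>. This is harmless, since
  \<open>max_fun_upper\<close> and \<open>max_fun_PL\<close> hold for every maximizer.\<close>

lemma inexact_gradient:
  assumes "\<gamma> > 0" "y = inner_output L22 (\<mu>2 * \<gamma>) f x y0"
  obtains w where "maximizer x w" "norm (gradx f x y - gradx f x w) \<le> L12 * \<gamma>"
proof -
  obtain w where w: "maximizer x w" "norm (y - w) \<le> norm (grady f x y) / \<mu>2"
    using maximizer_near by blast
  have "norm (grady f x y) \<le> \<mu>2 * \<gamma>"
    using inner_output_grady[of "\<mu>2 * \<gamma>" x y0] assms pos by simp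
  then have "norm (grady f x y) / \<mu>2 \<le> \<gamma>" using pos by (simp add: field_simps)
  then have "norm (y - w) \<le> \<gamma>" using w(2) by linarith
  then have "L12 * norm (y - w) \<le> L12 * \<gamma>" using pos by simp
  moreover have "norm (gradx f x y - gradx f x w) \<le> L12 * norm (y - w)"
    using lip lipschitz_onD[of L12 UNIV "gradx f x" y w]
    by (simp add: lipschitz_gradients_def dist_norm)
  ultimately show thesis using that w(1) by force
qed

section \<open>Convergence of the outer method\<close>

lemma inexact_step:
  assumes "maximizer x w" "norm (v - gradx f x w) \<le> \<Delta>"
  shows "max_fun f (x - (1 / L) *\<^sub>R v) - max_fun f xs
    \<le> (1 - \<mu>1 / L) * (max_fun f x - max_fun f xs) + \<Delta>\<^sup>2 / (2 * L)"
proof -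
  define G where "G = gradx f x w"
  have "max_fun f (x - (1 / L) *\<^sub>R v) \<le> max_fun f x + G \<bullet> (- ((1 / L) *\<^sub>R v))
      + L / 2 * (norm (- ((1 / L) *\<^sub>R v)))\<^sup>2"
    using max_fun_upper[OF assms(1), of "x - (1 / L) *\<^sub>R v"] by (simp add: G_def)
  \<comment> \<open>Completing the square: the quadratic model is minimal at the exact step \<open>v = G\<close>.\<close>
  also have "\<dots> = max_fun f x + ((norm (v - G))\<^sup>2 - (norm G)\<^sup>2) / (2 * L)"
  proof -
    have "(norm (v - G))\<^sup>2 = (norm v)\<^sup>2 - 2 * (G \<bullet> v) + (norm G)\<^sup>2"
      by (simp add: power2_norm_eq_inner inner_diff_left inner_diff_right inner_commute)
    then show ?thesis using L_pos by (simp add: field_simps power2_eq_square)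
  qed
  also have "\<dots> \<le> max_fun f x + (\<Delta>\<^sup>2 - 2 * \<mu>1 * (max_fun f x - max_fun f xs)) / (2 * L)"
    using assms(2) max_fun_PL[OF assms(1)] L_pos
    by (intro add_left_mono divide_right_mono diff_mono power_mono) (auto simp: G_def)
  finally show ?thesis using L_pos by (simp add: field_simps)
qed

text \<open>If \<open>\<mu>1 > L\<close>, the contraction factor \<open>1 - \<mu>1 / L\<close> is negative, and the recursion of
  \<open>inexact_step\<close> cannot be iterated. This happens only for a constant \<open>max_fun f\<close>, as an exact step
  shows.\<close>

lemma \<mu>1_le_L_or_const: "\<mu>1 \<le> L \<or> max_fun f x = max_fun f xs"
proof (rule disjCI)
  assume "max_fun f x \<noteq> max_fun f xs"
  then have d: "max_fun f x - max_fun f xs > 0" using max_fun_min[of x] by simp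
  obtain w where w: "maximizer x w" using ex_maximizer by blast
  have "0 \<le> (1 - \<mu>1 / L) * (max_fun f x - max_fun f xs)"
    using inexact_step[OF w, of "gradx f x w" 0] max_fun_min[of "x - (1 / L) *\<^sub>R gradx f x w"]
    by simp
  with d have "0 \<le> 1 - \<mu>1 / L" by (simp add: zero_le_mult_iff)
  then show "\<mu>1 \<le> L" using L_pos by simp
qed

lemma residual_bound:
  assumes step: "\<And>k. x (Suc k) = x k - (1 / L) *\<^sub>R v k"
    and v: "\<And>k. \<exists>w. maximizer (x k) w \<and> norm (v k - gradx f (x k) w) \<le> \<Delta>"
    and C: "max_fun f (x 0) - max_fun f xs \<le> C" "C \<ge> 0"
  shows "max_fun f (x k) - max_fun f xs \<le> exp (- \<mu>1 / L) ^ k * C + \<Delta>\<^sup>2 / (2 * \<mu>1)"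
proof (cases "\<mu>1 \<le> L")
  case True
  \<comment> \<open>\<open>\<Delta>\<^sup>2 / (2 * \<mu>1)\<close> is the fixed point of the recursion for the residuals.\<close>
  have "max_fun f (x k) - max_fun f xs \<le> (1 - \<mu>1 / L) ^ k * C + \<Delta>\<^sup>2 / (2 * \<mu>1)"
  proof (induction k)
    case 0
    have "0 \<le> \<Delta>\<^sup>2 / (2 * \<mu>1)" using pos by simp
    then show ?case using C by simp
  next
    case (Suc k)
    have "max_fun f (x (Suc k)) - max_fun f xs
        \<le> (1 - \<mu>1 / L) * (max_fun f (x k) - max_fun f xs) + \<Delta>\<^sup>2 / (2 * L)"
      using inexact_step v[of k] unfolding step by blast
    also have "\<dots> \<le> (1 - \<mu>1 / L) * ((1 - \<mu>1 / L) ^ k * C + \<Delta>\<^sup>2 / (2 * \<mu>1)) + \<Delta>\<^sup>2 / (2 * L)"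
      using Suc True L_pos by (intro add_right_mono mult_left_mono) auto
    also have "\<dots> = (1 - \<mu>1 / L) ^ Suc k * C + \<Delta>\<^sup>2 / (2 * \<mu>1)"
      using L_pos pos by (simp add: field_simps)
    finally show ?case .
  qed
  moreover have "(1 - \<mu>1 / L) ^ k \<le> exp (- \<mu>1 / L) ^ k"
    using True L_pos exp_ge_add_one_self[of "- \<mu>1 / L"] by (intro power_mono) auto
  ultimately show ?thesis
    using mult_right_mono[OF _ C(2)] by (smt (verit))
next
  case False
  then have "max_fun f (x k) = max_fun f xs" using \<mu>1_le_L_or_const by blast
  then show ?thesis using C(2) pos by simp
qed

end

text \<open>The number of steps is chosen such that the linear rate \<open>exp (- \<mu> / L)\<close> reduces \<open>C\<close> to
  \<open>E\<close>. If the logarithm is negative, zero steps suffice.\<close>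

lemma exp_power_ceiling_le:
  fixes \<mu> L C E :: real
  assumes "\<mu> > 0" "L > 0" "C > 0" "E > 0"
  shows "exp (- \<mu> / L) ^ nat \<lceil>L / \<mu> * ln (C / E)\<rceil> * C \<le> E"
proof -
  define N where "N = nat \<lceil>L / \<mu> * ln (C / E)\<rceil>"
  have "L / \<mu> * ln (C / E) \<le> real N" unfolding N_def by (rule real_nat_ceiling_ge)
  then have "ln (C / E) \<le> real N * (\<mu> / L)" using assms by (simp add: field_simps)
  then have "real N * (- \<mu> / L) \<le> ln (E / C)" using assms by (simp add: ln_div)
  then have "exp (real N * (- \<mu> / L)) \<le> exp (ln (E / C))" by (simp only: exp_le_cancel_iff)
  also have "\<dots> = E / C" using assms by simp
  finally have "exp (- \<mu> / L) ^ N \<le> E / C" by (simp only: exp_of_nat_mult)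
  then show ?thesis using assms by (simp add: N_def pos_le_divide_eq)
qed

theorem mainTheorem3:
  fixes f :: "(real ^ 'n) \<times> (real ^ 'm) \<Rightarrow> real"
    and x :: "nat \<Rightarrow> real ^ 'n"
    and y0 yhat :: "nat \<Rightarrow> real ^ 'm"
    and xs :: "real ^ 'n" and ys :: "real ^ 'm"
    and \<mu>1 \<mu>2 L11 L12 L22 \<gamma> C1 :: real and N :: nat
  assumes "f differentiable_on UNIV"
    and "\<mu>1 > 0" "\<mu>2 > 0" "L11 > 0" "L12 > 0" "L22 > 0" "\<gamma> > 0" "C1 > 0"
    and "two_sided_PL \<mu>1 \<mu>2 f"
    and "lipschitz_gradients L11 L12 L22 f"
    and "minimax_point f xs ys"
    and "\<And>k. yhat k = inner_output L22 (\<mu>2 * \<gamma>) f (x k) (y0 k)"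
    and "\<And>k. x (Suc k) = x k - (\<mu>2 / (L11 * \<mu>2 + L12\<^sup>2)) *\<^sub>R gradx f (x k) (yhat k)"
    and "max_fun f (x 0) - max_fun f xs \<le> C1"
    and "N = num_steps \<mu>1 \<mu>2 L11 L12 \<gamma> C1 \<or>
         (N \<le> num_steps \<mu>1 \<mu>2 L11 L12 \<gamma> C1 \<and>
          norm (gradx f (x N) (yhat N)) \<le> L12 * \<gamma> * sqrt 6 \<and>
          (\<forall>k<N. \<not> norm (gradx f (x k) (yhat k)) \<le> L12 * \<gamma> * sqrt 6))"
  shows "\<exists>z. nearest_minimizer (max_fun f) (x N) z \<and>
             norm (x N - z) \<le> L12 * \<gamma> * sqrt 14 / \<mu>1"
proof -
  interpret PL_saddle f \<mu>1 \<mu>2 L11 L12 L22 xs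
    using assms by unfold_locales (auto simp: minimax_point_def)
  define \<Delta> where "\<Delta> = L12 * \<gamma>"
  have \<Delta>: "\<Delta> > 0" using assms by (simp add: \<Delta>_def)
  have L_eq: "L = (L11 * \<mu>2 + L12\<^sup>2) / \<mu>2" using pos by (simp add: L_def field_simps)
  have step: "x (Suc k) = x k - (1 / L) *\<^sub>R gradx f (x k) (yhat k)" for k
    using assms(13) by (simp add: L_eq)
  have inexact: "\<exists>w. maximizer (x k) w \<and> norm (gradx f (x k) (yhat k) - gradx f (x k) w) \<le> \<Delta>" for k
    using inexact_gradient[OF \<open>\<gamma> > 0\<close> assms(12)[of k]] unfolding \<Delta>_def by metis
  obtain z where z: "nearest_minimizer (max_fun f) (x N) z"
      "\<mu>1 / 2 * (norm (x N - z))\<^sup>2 \<le> max_fun f (x N) - max_fun f xs"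
    using max_fun_growth by blast
  from assms(15) have "norm (x N - z) \<le> \<Delta> * sqrt 14 / \<mu>1"
  proof (elim disjE conjE)
    assume N: "N = num_steps \<mu>1 \<mu>2 L11 L12 \<gamma> C1"
    define E where "E = 6 * \<Delta>\<^sup>2 / \<mu>1"
    have "(L11 * \<mu>2 + L12\<^sup>2) / (\<mu>1 * \<mu>2) = L / \<mu>1" "C1 * \<mu>1 / (6 * L12\<^sup>2 * \<gamma>\<^sup>2) = C1 / E"
      by (simp_all add: L_eq E_def \<Delta>_def power_mult_distrib mult_ac)
    then have "N = nat \<lceil>L / \<mu>1 * ln (C1 / E)\<rceil>"
      by (simp add: N num_steps_def)
    then have "exp (- \<mu>1 / L) ^ N * C1 \<le> E"
      using exp_power_ceiling_le[of \<mu>1 L C1 E] L_pos pos \<Delta> \<open>C1 > 0\<close> by (simp add: E_def)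
    with residual_bound[OF step inexact assms(14), of N] \<open>C1 > 0\<close> z(2)
    have "\<mu>1 / 2 * (norm (x N - z))\<^sup>2 \<le> 6 * \<Delta>\<^sup>2 / \<mu>1 + \<Delta>\<^sup>2 / (2 * \<mu>1)"
      by (simp add: E_def)
    also have "\<dots> \<le> 7 * \<Delta>\<^sup>2 / \<mu>1" using pos by (simp add: field_simps)
    finally show ?thesis
      by (rule distance_le_of_growth_and_PL) (use pos \<Delta> in \<open>auto simp: power_mult_distrib\<close>)
  next
    assume "norm (gradx f (x N) (yhat N)) \<le> L12 * \<gamma> * sqrt 6"
    then have stop: "norm (gradx f (x N) (yhat N)) \<le> \<Delta> * sqrt 6" by (simp add: \<Delta>_def)
    obtain w where w: "maximizer (x N) w"
        "norm (gradx f (x N) (yhat N) - gradx f (x N) w) \<le> \<Delta>"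
      using inexact by blast
    have "norm (gradx f (x N) w) \<le> \<Delta> * sqrt 6 + \<Delta>"
      using norm_triangle_sub[of "gradx f (x N) w" "gradx f (x N) (yhat N)"] stop w(2)
      by (simp add: norm_minus_commute)
    also have "\<dots> = \<Delta> * (sqrt 6 + 1)" by (simp add: algebra_simps)
    also have "\<dots> \<le> \<Delta> * sqrt 14"
    proof (intro mult_left_mono real_le_rsqrt)
      have "sqrt 6 \<le> 3" by (rule real_le_lsqrt) auto
      then show "(sqrt 6 + 1)\<^sup>2 \<le> 14" by (simp add: power2_sum)
    qed (use \<Delta> in simp)
    finally have "norm (gradx f (x N) w) \<le> \<Delta> * sqrt 14" .
    moreover have "norm (x N - z) \<le> norm (gradx f (x N) w) / \<mu>1"
      using z(2) max_fun_PL[OF w(1)] pos by (intro distance_le_of_growth_and_PL) auto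
    ultimately show ?thesis
      using pos by (meson divide_right_mono less_imp_le order_trans)
  qed
  then show ?thesis using z(1) unfolding \<Delta>_def by blast
qed

end
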